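(* For the SROP algorithm (described in the context) the following statements hold true. (i) The combination of steps (2), (3) and (4) of the algorithm amounts to $y_k\in P_{\Omega_1}(x_k)$. (ii) Step (5) of the algorithm amounts to $z_k\in P_{\Omega_2}(y_k)$. (iii) The combination of steps (6) and (1) of the algorithm amounts to $x_{k+1}\in P_{\Omega_3}(z_k)$. In other words, the SROP algorithm is characterized by the fixed point operator $T$ given by $$x\mapsto T(x)\equiv P_{\Omega_3}P_{\Omega_2}P_{\Omega_1}(x)\qquad \forall x\in\mathbb{C}^{n\times n}.$$
   Context: The underlying space is $\mathbb{C}^{n\times n}$ with the Frobenius norm $\|\cdot\|$; $j$ is the imaginary unit; $\odot$ is element-wise multiplication; $\exp$, $|\cdot|$, $|\cdot|^2$, $\sqrt{\ }$, division and $\arg$ are applied element-wise, with $\arg$ taking values in $(-\pi,\pi]$; $\|\cdot\|_0$ is the number of nonzero entries. $\mathcal{F}$ is the discrete two-dimensional Fourier transform on $\mathbb{C}^{n\times n}$. Given data: the amplitude modulation $\chi\in\mathbb{R}_+^{n\times n}$, assumed uniform, i.e. all its entries equal the same constant $r>0$; the phase diversity $\Phi^d\in\mathbb{R}^{n\times n}$; the intensity image $b\in\mathbb{R}_+^{n\times n}$; the sparsity parameter $s\in\mathbb{N}$. Constraint sets: $\Omega_1=\{x\in\mathbb{C}^{n\times n}: |\mathcal{F}(x\odot\exp(j\Phi^d))|^2=b\}$, $\Omega_2=\{x\in\mathbb{C}^{n\times n}: |x|=\chi\}$, $\Omega_3=\{x\in\Omega_2: \|\arg(x)\|_0\le s\}$.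 For a set $\Omega\subset\mathbb{C}^{n\times n}$, the (set-valued) projection operator is $P_\Omega(x)=\{w\in\Omega: \|x-w\|=\inf_{v\in\Omega}\|x-v\|\}$. An operator $T$ (possibly set-valued) generates iterative sequences by $x_{k+1}\in T(x_k)$. $\mathcal{J}=\{(p,q): 1\le p,q\le n\}$ is the set of all indices, and for a real or complex $n\times n$ array $\mathcal{O}$, $C_s(\mathcal{O})$ is the set of all $s$-element subsets $J\subset\mathcal{J}$ with $\min_{\xi\in J}|\mathcal{O}(\xi)|\ge\max_{\xi\in\mathcal{J}\setminus J}|\mathcal{O}(\xi)|$. SROP (sparsity regularization on phase) algorithm: starting from an initial guess $\Phi_0$, given $\Phi_k$ perform (1) $x_k=\chi\odot\exp(j\Phi_k)$; (2) $X_k=\mathcal{F}(x_k\odot\exp(j\Phi^d))$; (3) $Y_k=\sqrt{b}\odot\frac{X_k}{|X_k|}$; (4) $y_k=\exp(-j\Phi^d)\odot\mathcal{F}^{-1}(Y_k)$; (5) $z_k=\chi\odot\exp(j\arg(y_k))$; (6) find $J\in C_s(\varphi)$, where $\varphi=\arg(z_k)$, and set $\Phi_{k+1}(\xi)=\varphi(\xi)$ if $\xi\in J$ and $\Phi_{k+1}(\xi)=0$ if $\xi\in\mathcal{J}\setminus J$. *)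

theory Defs
  imports "HOL-Analysis.Analysis"
begin

(* n x n arrays are elements of 'a ^ 'n ^ 'n with n = CARD('n); 'n is linearly ordered, so that
   the rows and columns are numbered 0, ..., n - 1 by index.  On these types the library's norm
   is the Frobenius norm and the library's product is element-wise. *)

type_synonym ('a, 'n) array = "'a ^ 'n ^ 'n"

definition index :: "'n::{finite,linorder} \<Rightarrow> nat" where
  "index i = card {i'. i' < i}"

(* Discrete two-dimensional Fourier transform with normalising factor c: c = 1 is the
   unnormalised transform and c = 1/n the unitary one. *)
definition dft2 :: "real \<Rightarrow> (complex, 'n) array \<Rightarrow> (complex, 'n::{finite,linorder}) array" where
  "dft2 c A = (\<chi> u v. of_real c * (\<Sum>p\<in>UNIV. \<Sum>q\<in>UNIV. A $ p $ q *
     exp (- 2 * of_real pi * \<i> * of_nat (index u * index p + index v * index q) / of_nat CARD('n))))"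

definition idft2 :: "real \<Rightarrow> (complex, 'n) array \<Rightarrow> (complex, 'n::{finite,linorder}) array" where
  "idft2 c = inv (dft2 c)"

definition cplx :: "(real, 'n::finite) array \<Rightarrow> (complex, 'n) array" where
  "cplx A = (\<chi> p q. of_real (A $ p $ q))"

definition expj :: "(real, 'n::finite) array \<Rightarrow> (complex, 'n) array" where
  "expj \<Phi> = (\<chi> p q. exp (\<i> * of_real (\<Phi> $ p $ q)))"

definition arg :: "(complex, 'n::finite) array \<Rightarrow> (real, 'n) array" where
  "arg A = (\<chi> p q. Arg (A $ p $ q))"

definition norm0 :: "(real, 'n::finite) array \<Rightarrow> nat" where
  "norm0 A = card {(p, q). A $ p $ q \<noteq> 0}"

definition Omega1 ::
  "real \<Rightarrow> (real, 'n) array \<Rightarrow> (real, 'n) array \<Rightarrow> (complex, 'n::{finite,linorder}) array set" where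
  "Omega1 c \<Phi>d b = {x. \<forall>p q. (cmod (dft2 c (x * expj \<Phi>d) $ p $ q))\<^sup>2 = b $ p $ q}"

definition Omega2 :: "(real, 'n::finite) array \<Rightarrow> (complex, 'n) array set" where
  "Omega2 amp = {x. \<forall>p q. cmod (x $ p $ q) = amp $ p $ q}"

definition Omega3 :: "(real, 'n::finite) array \<Rightarrow> nat \<Rightarrow> (complex, 'n) array set" where
  "Omega3 amp s = {x \<in> Omega2 amp. norm0 (arg x) \<le> s}"

definition projection :: "'a::real_normed_vector set \<Rightarrow> 'a \<Rightarrow> 'a set" where
  "projection \<Omega> x = {w \<in> \<Omega>. norm (x - w) = (INF v\<in>\<Omega>. norm (x - v))}"

(* The s-element index sets J with min over J >= max over the complement; the pairwise form is
   also meaningful when J or its complement is empty. *)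
definition C_set :: "nat \<Rightarrow> ('a::real_normed_vector, 'n::finite) array \<Rightarrow> ('n \<times> 'n) set set" where
  "C_set s A = {J. card J = s \<and>
     (\<forall>(p, q)\<in>J. \<forall>(p', q')\<in>- J. norm (A $ p $ q) \<ge> norm (A $ p' $ q'))}"

(* The admissible values of X / |X|: at entries where X vanishes the quotient is 0/0, and any
   unimodular value is admitted there (the default value 0 of division would leave Omega1). *)
definition unit_phases :: "(complex, 'n::finite) array \<Rightarrow> (complex, 'n) array set" where
  "unit_phases X = {U. \<forall>p q. if X $ p $ q = 0 then cmod (U $ p $ q) = 1
     else U $ p $ q = X $ p $ q / of_real (cmod (X $ p $ q))}"

(* The admissible values of arg y: at entries where y vanishes the argument is undetermined, and
   any value in (-pi, pi] is admitted, in particular the value Arg 0 = 0 of the library. *)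
definition args :: "(complex, 'n::finite) array \<Rightarrow> ((real, 'n) array) set" where
  "args y = {\<theta>. \<forall>p q. if y $ p $ q = 0 then \<theta> $ p $ q \<in> {- pi<..pi}
     else \<theta> $ p $ q = Arg (y $ p $ q)}"

definition step1 :: "(real, 'n::finite) array \<Rightarrow> (real, 'n) array \<Rightarrow> (complex, 'n) array" where
  "step1 amp \<Phi> = cplx amp * expj \<Phi>"

definition steps234 ::
  "real \<Rightarrow> (real, 'n) array \<Rightarrow> (real, 'n) array \<Rightarrow> (complex, 'n) array \<Rightarrow>
    (complex, 'n::{finite,linorder}) array \<Rightarrow> bool" where
  "steps234 c \<Phi>d b x y \<longleftrightarrow> (\<exists>X U Y.
     X = dft2 c (x * expj \<Phi>d) \<and>
     U \<in> unit_phases X \<and> Y = (\<chi> p q. of_real (sqrt (b $ p $ q))) * U \<and>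
     y = expj (- \<Phi>d) * idft2 c Y)"

definition step5 :: "(real, 'n::finite) array \<Rightarrow> (complex, 'n) array \<Rightarrow> (complex, 'n) array \<Rightarrow> bool" where
  "step5 amp y z \<longleftrightarrow> (\<exists>\<theta>\<in>args y. z = cplx amp * expj \<theta>)"

definition step6 :: "nat \<Rightarrow> (complex, 'n::finite) array \<Rightarrow> (real, 'n) array \<Rightarrow> bool" where
  "step6 s z \<Phi>' \<longleftrightarrow> (\<exists>J\<in>C_set s (arg z).
     \<Phi>' = (\<chi> p q. if (p, q) \<in> J then arg z $ p $ q else 0))"

definition srop_run ::
  "real \<Rightarrow> (real, 'n) array \<Rightarrow> (real, 'n) array \<Rightarrow> (real, 'n) array \<Rightarrow> nat \<Rightarrow>
    (nat \<Rightarrow> (real, 'n) array) \<Rightarrow> (nat \<Rightarrow> (complex, 'n) array) \<Rightarrow> (nat \<Rightarrow> (complex, 'n) array) \<Rightarrow>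
    (nat \<Rightarrow> (complex, 'n::{finite,linorder}) array) \<Rightarrow> bool" where
  "srop_run c amp \<Phi>d b s \<Phi> x y z \<longleftrightarrow> (\<forall>k.
     x k = step1 amp (\<Phi> k) \<and>
     steps234 c \<Phi>d b (x k) (y k) \<and>
     step5 amp (y k) (z k) \<and>
     step6 s (z k) (\<Phi> (Suc k)))"

definition T_srop ::
  "real \<Rightarrow> (real, 'n) array \<Rightarrow> (real, 'n) array \<Rightarrow> (real, 'n) array \<Rightarrow> nat \<Rightarrow>
    (complex, 'n) array \<Rightarrow> (complex, 'n::{finite,linorder}) array set" where
  "T_srop c amp \<Phi>d b s x =
     (\<Union>y\<in>projection (Omega1 c \<Phi>d b) x. \<Union>z\<in>projection (Omega2 amp) y. projection (Omega3 amp s) z)"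

end

theory Submission
  imports Defs
begin

text \<open>
  All three projections are solved by the same observation: in the Frobenius norm the squared
  distance is a sum over the entries of the arrays, so a problem in which the entries can be chosen
  freely splits into one problem per entry. For the set of arrays with prescribed moduli
  \<open>m \<ge> 0\<close> the problem at one entry is to find the nearest point to \<open>X\<close> on a circle of radius \<open>m\<close>
  around \<open>0\<close>: it is \<open>m * (X / \<bar>X\<bar>)\<close>, and every point of the circle if \<open>X = 0\<close>
  (\<open>projection_Omega2\<close>). This gives (ii) at once, since choosing admissible arguments of \<open>y\<close> is
  the same as choosing admissible phases (\<open>args_expj_unit_phases\<close>).

  For (i), the map \<open>x \<mapsto> F (x * exp (j \<Phi>d))\<close> multiplies all distances by the same factor
  \<open>c n\<close>: this is Parseval's identity (\<open>norm_dft2\<close>), together with the fact that multiplication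
  by unimodular entries preserves the norm. It is also bijective, because a linear injection of a
  finite-dimensional space into itself is surjective. A bijective similarity carries nearest points
  to nearest points, and it pulls back the set of arrays of moduli \<open>sqrt b\<close> to \<open>\<Omega>\<^sub>1\<close>, so (i) is
  again the projection onto prescribed moduli.

  For (iii), let \<open>s \<le> n\<^sup>2\<close>; otherwise \<open>C\<^sub>s\<close> is empty and step (6) has no outcome. Then an element
  of \<open>\<Omega>\<^sub>3\<close> equals \<open>r\<close> outside some index set \<open>J\<close> of \<open>s\<close> elements. Once
  \<open>J\<close> is fixed, the unique best choice is to keep \<open>z\<close> on \<open>J\<close> (\<open>keep_on_support_nearer\<close>), at the
  cost of \<open>\<bar>z - r\<bar>\<^sup>2\<close> summed outside \<open>J\<close>. The best \<open>J\<close> are therefore those that collect the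
  \<open>s\<close> largest values of \<open>\<bar>z - r\<bar>\<close>. Since \<open>z\<close> has constant modulus \<open>r\<close>, the chord
  \<open>\<bar>z - r\<bar>\<close> is an increasing function of \<open>\<bar>Arg z\<bar>\<close>, so they are exactly the members of
  \<open>C\<^sub>s (arg z)\<close> (\<open>C_set_arg_iff_nearest\<close>). This is where uniformity of the amplitude enters.

  The statements about whole runs follow by chaining the three equivalences along the iteration.
\<close>

section \<open>Projections\<close>

lemma projection_iff_nearest:
  "w \<in> projection \<Omega> x \<longleftrightarrow> w \<in> \<Omega> \<and> (\<forall>v\<in>\<Omega>. norm (x - w) \<le> norm (x - v))"
proof (cases "w \<in> \<Omega>")
  case True
  have bdd: "bdd_below ((\<lambda>v. norm (x - v)) ` \<Omega>)"
    by (rule bdd_belowI[of _ 0]) auto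
  have low: "(INF v\<in>\<Omega>. norm (x - v)) \<le> norm (x - v)" if "v \<in> \<Omega>" for v
    using bdd that by (rule cINF_lower)
  show ?thesis
  proof
    assume "w \<in> projection \<Omega> x"
    then show "w \<in> \<Omega> \<and> (\<forall>v\<in>\<Omega>. norm (x - w) \<le> norm (x - v))"
      using low by (auto simp: projection_def)
  next
    assume r: "w \<in> \<Omega> \<and> (\<forall>v\<in>\<Omega>. norm (x - w) \<le> norm (x - v))"
    have "norm (x - w) \<le> (INF v\<in>\<Omega>. norm (x - v))"
      using r by (intro cINF_greatest) auto
    then show "w \<in> projection \<Omega> x"
      using r low[OF True] by (auto simp: projection_def)
  qed
qed (auto simp: projection_def)

text \<open>Scaling all distances by one positive factor does not change which points are nearest.\<close>

lemma projection_vimage_similarity: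
  fixes h :: "'a::real_normed_vector \<Rightarrow> 'b::real_normed_vector"
  assumes "surj h" "\<kappa> > 0" "\<And>x w. norm (h x - h w) = \<kappa> * norm (x - w)"
  shows "w \<in> projection (h -` M) x \<longleftrightarrow> h w \<in> projection M (h x)"
proof -
  have "(\<forall>v\<in>h -` M. norm (x - w) \<le> norm (x - v)) \<longleftrightarrow>
        (\<forall>v\<in>h -` M. norm (h x - h w) \<le> norm (h x - h v))"
    using assms(2) by (simp add: assms(3))
  also have "\<dots> \<longleftrightarrow> (\<forall>V\<in>M. norm (h x - h w) \<le> norm (h x - V))"
    using assms(1) by (metis surj_def vimage_eq)
  finally show ?thesis
    by (simp add: projection_iff_nearest)
qed

lemma norm_array_squared:
  fixes A :: "('a::real_normed_vector, 'n::finite) array"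
  shows "(norm A)\<^sup>2 = (\<Sum>\<xi>\<in>UNIV. (norm (A $ fst \<xi> $ snd \<xi>))\<^sup>2)"
proof -
  have "(norm A)\<^sup>2 = (\<Sum>p\<in>UNIV. \<Sum>q\<in>UNIV. (norm (A $ p $ q))\<^sup>2)"
    by (simp add: norm_vec_def L2_set_def sum_nonneg)
  also have "\<dots> = (\<Sum>\<xi>\<in>UNIV \<times> UNIV. (norm (A $ fst \<xi> $ snd \<xi>))\<^sup>2)"
    by (simp add: sum.cartesian_product case_prod_beta)
  finally show ?thesis by simp
qed

lemma norm_array_le_iff:
  fixes A :: "('a::real_normed_vector, 'n::finite) array"
    and B :: "('b::real_normed_vector, 'm::finite) array"
  shows "norm A \<le> norm B \<longleftrightarrow>
    (\<Sum>\<xi>\<in>UNIV. (norm (A $ fst \<xi> $ snd \<xi>))\<^sup>2) \<le> (\<Sum>\<xi>\<in>UNIV. (norm (B $ fst \<xi> $ snd \<xi>))\<^sup>2)"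
  unfolding norm_array_squared[symmetric] by (simp add: abs_le_square_iff[symmetric])

section \<open>Prescribed moduli\<close>

lemma expj_index [simp]: "expj \<Phi> $ p $ q = exp (\<i> * of_real (\<Phi> $ p $ q))"
  by (simp add: expj_def)

lemma cplx_index [simp]: "cplx A $ p $ q = of_real (A $ p $ q)"
  by (simp add: cplx_def)

text \<open>
  The distance from \<open>X\<close> to a point of a circle around \<open>0\<close> is at least the difference of the
  moduli; equality is the equality case of the Cauchy--Schwarz inequality, which forces the two
  points onto the same ray.
\<close>

lemma dist_to_circle_eq_iff:
  fixes X W :: complex
  assumes "X \<noteq> 0"
  shows "(cmod (X - W))\<^sup>2 = (cmod X - cmod W)\<^sup>2 \<longleftrightarrow> W = of_real (cmod W) * (X / of_real (cmod X))"
proof -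
  have "(cmod (X - W))\<^sup>2 = (cmod X)\<^sup>2 + (cmod W)\<^sup>2 - 2 * (X \<bullet> W)"
    by (simp add: power2_norm_eq_inner inner_diff inner_commute algebra_simps)
  then have "(cmod (X - W))\<^sup>2 = (cmod X - cmod W)\<^sup>2 \<longleftrightarrow> X \<bullet> W = cmod X * cmod W"
    by (auto simp: power2_diff)
  also have "\<dots> \<longleftrightarrow> cmod X *\<^sub>R W = cmod W *\<^sub>R X"
    by (rule norm_cauchy_schwarz_eq)
  also have "\<dots> \<longleftrightarrow> W = of_real (cmod W) * (X / of_real (cmod X))"
    using assms by (auto simp: scaleR_conv_of_real field_simps)
  finally show ?thesis .
qed

lemma unit_phases_norm: "U \<in> unit_phases X \<Longrightarrow> cmod (U $ p $ q) = 1"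
  by (cases "X $ p $ q = 0") (auto simp: unit_phases_def norm_divide split: if_splits)

lemma unit_phases_nonempty: "\<exists>U. U \<in> unit_phases X"
proof
  show "(\<chi> p q. if X $ p $ q = 0 then 1 else X $ p $ q / of_real (cmod (X $ p $ q))) \<in> unit_phases X"
    by (simp add: unit_phases_def)
qed

text \<open>
  An entrywise form of the projection onto prescribed moduli. At an entry with \<open>X = 0\<close> all points
  of the circle are equally near, which matches the free choice of the phase there.
\<close>

lemma unit_phases_iff_nearest:
  assumes "\<And>p q. m $ p $ q \<ge> 0"
  shows "(\<exists>U\<in>unit_phases X. W = cplx m * U) \<longleftrightarrow>
    (\<forall>p q. cmod (W $ p $ q) = m $ p $ q \<and>
       (cmod (X $ p $ q - W $ p $ q))\<^sup>2 = (cmod (X $ p $ q) - m $ p $ q)\<^sup>2)"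
    (is "?L \<longleftrightarrow> (\<forall>p q. ?R p q)")
proof
  assume ?L
  then obtain U where U: "U \<in> unit_phases X" and W: "W = cplx m * U" by blast
  show "\<forall>p q. ?R p q"
  proof (intro allI)
    fix p q
    have mod: "cmod (W $ p $ q) = m $ p $ q"
      using assms unit_phases_norm[OF U] by (simp add: W norm_mult)
    show "?R p q"
    proof (cases "X $ p $ q = 0")
      case False
      then have "W $ p $ q = of_real (cmod (W $ p $ q)) * (X $ p $ q / of_real (cmod (X $ p $ q)))"
        using U unfolding mod by (simp add: W unit_phases_def)
      then show ?thesis
        using dist_to_circle_eq_iff[OF False, of "W $ p $ q"] mod by metis
    qed (simp add: mod)
  qed
next
  assume R: "\<forall>p q. ?R p q"
  obtain U0 where U0: "U0 \<in> unit_phases X" using unit_phases_nonempty by blast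
  \<comment> \<open>Where \<open>m = 0\<close> the phase cannot be recovered from \<open>W = 0\<close>, and any admissible one will do.\<close>
  define U :: "(complex, 'a) array" where
    "U = (\<chi> p q. if X $ p $ q = 0 \<and> m $ p $ q \<noteq> 0 then W $ p $ q / of_real (m $ p $ q)
        else U0 $ p $ q)"
  have "U \<in> unit_phases X"
    using U0 R unit_phases_norm[OF U0] assms
    by (auto simp: U_def unit_phases_def norm_divide)
  moreover have "W $ p $ q = cplx m $ p $ q * U $ p $ q" for p q
  proof (cases "m $ p $ q = 0 \<or> X $ p $ q = 0")
    case True
    then show ?thesis using R[rule_format, of p q] by (auto simp: U_def)
  next
    case False
    then have "W $ p $ q = of_real (m $ p $ q) * (X $ p $ q / of_real (cmod (X $ p $ q)))"
      using dist_to_circle_eq_iff[of "X $ p $ q" "W $ p $ q"] R[rule_format, of p q] by simp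
    also have "X $ p $ q / of_real (cmod (X $ p $ q)) = U $ p $ q"
      using False U0 by (simp add: U_def unit_phases_def)
    finally show ?thesis by simp
  qed
  then have "W = cplx m * U" by (simp add: vec_eq_iff)
  ultimately show ?L by blast
qed

text \<open>
  The sum of the entrywise lower bounds is attained, so an array is nearest exactly when it attains
  the bound at every entry.
\<close>

lemma projection_Omega2:
  fixes m :: "(real, 'n::finite) array"
  assumes "\<And>p q. m $ p $ q \<ge> 0"
  shows "W \<in> projection (Omega2 m) X \<longleftrightarrow> (\<exists>U\<in>unit_phases X. W = cplx m * U)"
proof -
  let ?d = "\<lambda>W \<xi>. (cmod ((X - W) $ fst \<xi> $ snd \<xi>))\<^sup>2"
  let ?e = "\<lambda>\<xi>. (cmod (X $ fst \<xi> $ snd \<xi>) - m $ fst \<xi> $ snd \<xi>)\<^sup>2"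
  have le: "?e \<xi> \<le> ?d V \<xi>" if "V \<in> Omega2 m" for V \<xi>
  proof -
    have "\<bar>cmod (X $ fst \<xi> $ snd \<xi>) - cmod (V $ fst \<xi> $ snd \<xi>)\<bar> \<le>
        cmod (X $ fst \<xi> $ snd \<xi> - V $ fst \<xi> $ snd \<xi>)"
      by (rule norm_triangle_ineq3)
    then show ?thesis
      using that by (simp add: Omega2_def abs_le_square_iff[symmetric])
  qed
  have sum_le: "sum ?e UNIV \<le> sum (?d V) UNIV" if "V \<in> Omega2 m" for V
    using le[OF that] by (intro sum_mono) auto
  have attained: "(\<exists>U\<in>unit_phases X. V = cplx m * U) \<longleftrightarrow> V \<in> Omega2 m \<and> sum (?d V) UNIV = sum ?e UNIV"
    for V
  proof -
    have "sum (?d V) UNIV = sum ?e UNIV \<longleftrightarrow> (\<forall>\<xi>. ?d V \<xi> = ?e \<xi>)" if V: "V \<in> Omega2 m"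
    proof
      assume "sum (?d V) UNIV = sum ?e UNIV"
      then have "sum ?e UNIV = sum (?d V) UNIV" by (rule sym)
      then show "\<forall>\<xi>. ?d V \<xi> = ?e \<xi>"
        using sum_mono_inv[of ?e UNIV "?d V"] le[OF V] by fastforce
    qed simp
    then show ?thesis
      unfolding unit_phases_iff_nearest[OF assms] by (auto simp: Omega2_def)
  qed
  obtain U where "U \<in> unit_phases X" using unit_phases_nonempty by blast
  then have best: "cplx m * U \<in> Omega2 m" "sum (?d (cplx m * U)) UNIV = sum ?e UNIV"
    using attained[of "cplx m * U"] by blast+
  show ?thesis
    unfolding attained projection_iff_nearest norm_array_le_iff
  proof
    assume W: "W \<in> Omega2 m \<and> (\<forall>V\<in>Omega2 m. sum (?d W) UNIV \<le> sum (?d V) UNIV)"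
    then have "sum (?d W) UNIV \<le> sum ?e UNIV"
      unfolding best(2)[symmetric] using best(1) by blast
    then show "W \<in> Omega2 m \<and> sum (?d W) UNIV = sum ?e UNIV"
      using W sum_le[of W] by linarith
  next
    assume W: "W \<in> Omega2 m \<and> sum (?d W) UNIV = sum ?e UNIV"
    then show "W \<in> Omega2 m \<and> (\<forall>V\<in>Omega2 m. sum (?d W) UNIV \<le> sum (?d V) UNIV)"
      using sum_le by (auto simp del: vector_minus_component)
  qed
qed

text \<open>
  The step of the algorithm that works with arguments and the one that works with quotients
  \<open>X / \<bar>X\<bar>\<close> resolve the ambiguity at zero entries in the same way.
\<close>

lemma args_expj_unit_phases:
  "(\<exists>\<theta>\<in>args y. U = expj \<theta>) \<longleftrightarrow> U \<in> unit_phases y"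
proof -
  have polar: "w = exp (\<i> * of_real (Arg w))" if "cmod w = 1" for w
    using that Arg_eq[of w] by force
  have Arg_phase: "exp (\<i> * of_real (Arg w)) = w / of_real (cmod w)" if "w \<noteq> 0" for w
    using Arg_eq[OF that] that by (simp add: field_simps)
  show ?thesis
  proof
    assume "\<exists>\<theta>\<in>args y. U = expj \<theta>"
    then show "U \<in> unit_phases y"
      using Arg_phase by (fastforce simp: args_def unit_phases_def)
  next
    assume U: "U \<in> unit_phases y"
    define \<theta> where "\<theta> = (\<chi> p q. if y $ p $ q = 0 then Arg (U $ p $ q) else Arg (y $ p $ q))"
    have "\<theta> \<in> args y"
      using mpi_less_Arg Arg_le_pi by (auto simp: \<theta>_def args_def)
    moreover have "U $ p $ q = expj \<theta> $ p $ q" for p q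
      using U Arg_phase[of "y $ p $ q"] polar[OF unit_phases_norm[OF U, of p q]]
      by (auto simp: \<theta>_def unit_phases_def)
    ultimately show "\<exists>\<theta>\<in>args y. U = expj \<theta>"
      by (auto simp: vec_eq_iff intro!: bexI[of _ \<theta>])
  qed
qed

lemma step5_iff_projection:
  assumes "\<And>p q. amp $ p $ q \<ge> 0"
  shows "step5 amp y z \<longleftrightarrow> z \<in> projection (Omega2 amp) y"
proof -
  have "step5 amp y z \<longleftrightarrow> (\<exists>U. (\<exists>\<theta>\<in>args y. U = expj \<theta>) \<and> z = cplx amp * U)"
    unfolding step5_def by blast
  then show ?thesis
    unfolding projection_Omega2[OF assms] args_expj_unit_phases by (simp only: Bex_def)
qed

section \<open>The discrete Fourier transform\<close>

lemma bij_betw_index: "bij_betw index (UNIV :: 'n::{finite,linorder} set) {..<CARD('n)}"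
proof -
  have "index i < index j" if "i < j" for i j :: 'n
    unfolding index_def using that by (intro psubset_card_mono) auto
  then have inj: "inj (index :: 'n \<Rightarrow> nat)"
    by (metis injI linorder_neqE less_irrefl)
  have "index i < CARD('n)" for i :: 'n
    unfolding index_def by (rule psubset_card_mono) auto
  then have "range (index :: 'n \<Rightarrow> nat) = {..<CARD('n)}"
    by (intro card_subset_eq) (auto simp: card_image[OF inj])
  then show ?thesis
    using inj by (simp add: bij_betw_def)
qed

definition dft_kernel :: "'n::{finite,linorder} \<Rightarrow> 'n \<Rightarrow> complex" where
  "dft_kernel u p = exp (- 2 * of_real pi * \<i> * of_nat (index u * index p) / of_nat CARD('n))"

text \<open>
  The kernel of the two-dimensional transform is a product, so the transform can be computed along
  the rows and then along the columns; this reduces Parseval's identity to one dimension.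
\<close>

lemma dft2_index:
  "dft2 c A $ u $ v = of_real c *
     (\<Sum>p\<in>UNIV. (\<Sum>q\<in>UNIV. A $ p $ q * dft_kernel v q) * dft_kernel u p)"
proof -
  have "exp (- 2 * of_real pi * \<i> * of_nat (index u * index p + index v * index q) / of_nat CARD('a))
      = dft_kernel v q * dft_kernel u p" for p q
    unfolding dft_kernel_def exp_add[symmetric]
    by (simp add: add_divide_distrib diff_divide_distrib algebra_simps)
  then show ?thesis
    by (simp add: dft2_def sum_distrib_right mult.assoc)
qed

lemma dft_kernel_orthogonal:
  fixes p q :: "'n::{finite,linorder}"
  shows "(\<Sum>u\<in>UNIV. dft_kernel u p * cnj (dft_kernel u q)) = (if p = q then of_nat CARD('n) else 0)"
proof -
  define N where "N = CARD('n)"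
  have N: "N > 0" by (simp add: N_def)
  \<comment> \<open>The sum is a geometric series in an \<open>n\<close>-th root of unity, which is \<open>1\<close> only for \<open>p = q\<close>.\<close>
  define w where "w = exp (2 * of_real pi * \<i> * (of_nat (index q) - of_nat (index p)) / of_nat N)"
  have term_eq: "dft_kernel u p * cnj (dft_kernel u q) = w ^ index u" for u
    unfolding dft_kernel_def w_def N_def exp_of_nat_mult[symmetric] exp_cnj exp_add[symmetric]
    by (rule arg_cong[where f = exp]) (simp add: field_simps)
  have "(\<Sum>u\<in>(UNIV::'n set). w ^ index u) = (\<Sum>k<N. w ^ k)"
    unfolding N_def by (rule sum.reindex_bij_betw[OF bij_betw_index])
  also have "\<dots> = (if p = q then of_nat N else 0)"
  proof (cases "p = q")
    case True
    then show ?thesis by (simp add: w_def)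
  next
    case False
    have "w ^ N = exp (\<i> * (of_int (int (index q) - int (index p)) * (of_real pi * 2)))"
      unfolding w_def exp_of_nat_mult[symmetric] using N
      by (intro arg_cong[where f = exp]) (simp add: field_simps)
    also have "\<dots> = 1"
      by (rule exp_2pi_1_int)
    finally have wN: "w ^ N = 1" .
    have "w \<noteq> 1"
    proof
      assume "w = 1"
      then obtain k :: int
        where "Im (2 * of_real pi * \<i> * (of_nat (index q) - of_nat (index p)) / of_nat N) = of_int (2 * k) * pi"
        unfolding w_def exp_eq_1 by blast
      then have "2 * pi * (real (index q) - real (index p)) = 2 * pi * (of_int k * real N)"
        using N by (simp add: field_simps)
      then have "real (index q) - real (index p) = of_int k * real N"
        by (subst (asm) mult_cancel_left) simp
      then have "of_int (int (index q) - int (index p)) = (of_int (k * int N) :: real)"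
        by simp
      then have "int (index q) - int (index p) = k * int N"
        by (simp only: of_int_eq_iff)
      then have dvd: "int N dvd int (index q) - int (index p)" by simp
      have "index p < N" "index q < N"
        using bij_betw_index[where 'n = 'n] by (auto simp: bij_betw_def N_def)
      then have small: "\<bar>int (index q) - int (index p)\<bar> < int N" by linarith
      have "index p = index q"
      proof (rule ccontr)
        assume "index p \<noteq> index q"
        then have "\<bar>int N\<bar> \<le> \<bar>int (index q) - int (index p)\<bar>"
          using dvd by (intro dvd_imp_le_int) simp_all
        then show False using small by linarith
      qed
      then show False
        using False bij_betw_imp_inj_on[OF bij_betw_index[where 'n = 'n]] by (simp add: inj_eq)
    qed
    then show ?thesis
      using False wN by (simp add: geometric_sum)
  qed
  finally show ?thesis
    by (simp add: term_eq N_def)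
qed

lemma dft_kernel_parseval:
  fixes a :: "'n::{finite,linorder} \<Rightarrow> complex"
  shows "(\<Sum>u\<in>UNIV. (cmod (\<Sum>p\<in>UNIV. a p * dft_kernel u p))\<^sup>2) =
    real CARD('n) * (\<Sum>p\<in>UNIV. (cmod (a p))\<^sup>2)"
proof -
  have "complex_of_real (\<Sum>u\<in>UNIV. (cmod (\<Sum>p\<in>UNIV. a p * dft_kernel u p))\<^sup>2)
    = (\<Sum>u\<in>UNIV. \<Sum>p\<in>UNIV. \<Sum>q\<in>UNIV. (a p * cnj (a q)) * (dft_kernel u p * cnj (dft_kernel u q)))"
    by (simp only: of_real_sum complex_norm_square cnj_sum sum_product complex_cnj_mult)
       (simp only: mult_ac)
  also have "\<dots> = (\<Sum>p\<in>UNIV. \<Sum>q\<in>UNIV. (a p * cnj (a q)) *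
      (\<Sum>u\<in>UNIV. dft_kernel u p * cnj (dft_kernel u q)))"
    unfolding sum_distrib_left
    by (rule trans[OF sum.swap], rule sum.cong[OF refl], rule sum.swap)
  also have "\<dots> = (\<Sum>p\<in>UNIV. \<Sum>q\<in>UNIV. if p = q then (a p * cnj (a q)) * of_nat CARD('n) else 0)"
    by (intro sum.cong refl) (simp add: dft_kernel_orthogonal)
  also have "\<dots> = complex_of_real (real CARD('n) * (\<Sum>p\<in>UNIV. (cmod (a p))\<^sup>2))"
    by (simp add: complex_norm_square sum_distrib_left mult_ac del: of_real_power)
  finally show ?thesis
    by (simp only: of_real_eq_iff)
qed

text \<open>
  Parseval's identity in two dimensions: the one-dimensional identity along the columns and then
  along the rows contributes a factor \<open>n\<close> to the squared norm each time.
\<close>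

lemma norm_dft2:
  fixes A :: "(complex, 'n::{finite,linorder}) array"
  assumes "c \<ge> 0"
  shows "norm (dft2 c A) = (c * real CARD('n)) * norm A"
proof -
  define B where "B = (\<lambda>v p. \<Sum>q\<in>UNIV. A $ p $ q * dft_kernel v q)"
  have norm2: "(norm M)\<^sup>2 = (\<Sum>p\<in>UNIV. \<Sum>q\<in>UNIV. (cmod (M $ p $ q))\<^sup>2)"
    for M :: "(complex, 'n) array"
    by (simp add: norm_vec_def L2_set_def sum_nonneg)
  have "(norm (dft2 c A))\<^sup>2 =
      (\<Sum>u\<in>UNIV. \<Sum>v\<in>UNIV. c\<^sup>2 * (cmod (\<Sum>p\<in>UNIV. B v p * dft_kernel u p))\<^sup>2)"
    by (simp add: norm2 dft2_index B_def norm_mult power_mult_distrib)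
  also have "\<dots> = c\<^sup>2 * (\<Sum>v\<in>UNIV. \<Sum>u\<in>UNIV. (cmod (\<Sum>p\<in>UNIV. B v p * dft_kernel u p))\<^sup>2)"
    by (subst sum.swap) (simp add: sum_distrib_left)
  also have "\<dots> = c\<^sup>2 * (real CARD('n) * (\<Sum>p\<in>UNIV. \<Sum>v\<in>UNIV. (cmod (B v p))\<^sup>2))"
    unfolding dft_kernel_parseval by (subst sum.swap) (simp add: sum_distrib_left)
  also have "\<dots> = c\<^sup>2 * (real CARD('n) * (real CARD('n) * (norm A)\<^sup>2))"
    unfolding B_def dft_kernel_parseval norm2 by (simp add: sum_distrib_left)
  also have "\<dots> = ((c * real CARD('n)) * norm A)\<^sup>2"
    by (simp add: power2_eq_square)
  finally show ?thesis
    by (rule power2_eq_imp_eq) (use assms in auto)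
qed

lemma linear_dft2: "linear (dft2 c)"
  by (rule linearI)
     (simp_all add: vec_eq_iff dft2_index sum.distrib sum_distrib_left
        scaleR_sum_right algebra_simps)

lemma bij_dft2:
  assumes "c > 0"
  shows "bij (dft2 c :: (complex, 'n) array \<Rightarrow> (complex, 'n::{finite,linorder}) array)"
proof -
  have "inj (dft2 c :: (complex, 'n) array \<Rightarrow> (complex, 'n) array)"
    unfolding linear_injective_0[OF linear_dft2]
  proof (intro allI impI)
    fix A :: "(complex, 'n) array"
    assume "dft2 c A = 0"
    then have "(c * real CARD('n)) * norm A = 0"
      using norm_dft2[of c A] assms by simp
    then show "A = 0" using assms by simp
  qed
  then show ?thesis
    using linear_injective_imp_surjective[OF linear_dft2] by (auto simp: bij_def)
qed

lemma norm_mult_expj: "norm (A * expj \<Phi>) = norm A"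
  by (simp add: norm_vec_def norm_mult)

text \<open>
  In the coordinates \<open>h x\<close>, the phase-shifted Fourier transform of \<open>x\<close>, the set \<open>\<Omega>\<^sub>1\<close> only
  prescribes moduli, and \<open>h\<close> is a bijective similarity.
\<close>

lemma steps234_iff_projection:
  fixes \<Phi>d b :: "(real, 'n::{finite,linorder}) array"
  assumes "\<And>p q. b $ p $ q \<ge> 0" "c > 0"
  shows "steps234 c \<Phi>d b x y \<longleftrightarrow> y \<in> projection (Omega1 c \<Phi>d b) x"
proof -
  define h :: "(complex, 'n) array \<Rightarrow> (complex, 'n) array" where "h x = dft2 c (x * expj \<Phi>d)" for x
  define m where "m = (\<chi> p q. sqrt (b $ p $ q))"
  have F: "bij (dft2 c :: (complex, 'n) array \<Rightarrow> (complex, 'n) array)"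
    using assms(2) by (rule bij_dft2)
  have shift: "expj (- \<Phi>d) * a * expj \<Phi>d = a" "expj (- \<Phi>d) * (a * expj \<Phi>d) = a" for a
    by (simp_all add: vec_eq_iff exp_minus)
  have inverse: "y = expj (- \<Phi>d) * idft2 c Y \<longleftrightarrow> h y = Y" for y Y
    unfolding h_def idft2_def
  proof
    assume "y = expj (- \<Phi>d) * inv (dft2 c) Y"
    then have "y * expj \<Phi>d = inv (dft2 c) Y" by (simp only: shift)
    then show "dft2 c (y * expj \<Phi>d) = Y"
      using F by (simp add: bij_is_surj surj_f_inv_f)
  next
    assume "dft2 c (y * expj \<Phi>d) = Y"
    then have "inv (dft2 c) Y = y * expj \<Phi>d"
      using F by (simp add: bij_inv_eq_iff[symmetric] bij_is_inj)
    then show "y = expj (- \<Phi>d) * inv (dft2 c) Y" by (simp only: shift)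
  qed
  then have "surj h"
    unfolding surj_def by metis
  moreover have "norm (h x - h w) = (c * real CARD('n)) * norm (x - w)" for x w
    unfolding h_def linear_diff[OF linear_dft2, symmetric]
    using assms(2) by (simp add: norm_dft2 norm_mult_expj left_diff_distrib[symmetric])
  moreover have "c * real CARD('n) > 0"
    using assms(2) by simp
  ultimately have "y \<in> projection (h -` Omega2 m) x \<longleftrightarrow> h y \<in> projection (Omega2 m) (h x)"
    by (intro projection_vimage_similarity)
  moreover have "h -` Omega2 m = Omega1 c \<Phi>d b"
  proof -
    have "cmod w = sqrt t \<longleftrightarrow> (cmod w)\<^sup>2 = t" if "t \<ge> 0" for w t
      using that by (metis norm_ge_zero real_sqrt_pow2 real_sqrt_unique)
    then show ?thesis
      using assms(1) by (auto simp: Omega1_def Omega2_def h_def m_def)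
  qed
  moreover have "steps234 c \<Phi>d b x y \<longleftrightarrow> (\<exists>U\<in>unit_phases (h x). h y = cplx m * U)"
    unfolding steps234_def
    by (auto simp: inverse h_def[symmetric] cplx_def m_def)
  moreover have "\<And>p q. m $ p $ q \<ge> 0"
    using assms(1) by (simp add: m_def)
  ultimately show ?thesis
    by (simp add: projection_Omega2)
qed

section \<open>Sparse phases\<close>

text \<open>
  Local and global optimality of an index set agree. In one direction, after subtracting the
  smallest value \<open>t\<close> on \<open>J\<close>, the summands are nonnegative on \<open>J\<close> and nonpositive outside, so no
  set of the same size can do better; in the other, exchanging one element of \<open>J\<close> for one outside
  must not increase the sum.
\<close>

lemma top_set_iff_max_sum:
  fixes g :: "'a::finite \<Rightarrow> real"
  shows "(\<forall>\<xi>\<in>J. \<forall>\<eta>\<in>- J. g \<eta> \<le> g \<xi>) \<longleftrightarrow> (\<forall>S::'a set. card S = card J \<longrightarrow> sum g S \<le> sum g J)"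
proof
  assume top: "\<forall>\<xi>\<in>J. \<forall>\<eta>\<in>- J. g \<eta> \<le> g \<xi>"
  show "\<forall>S::'a set. card S = card J \<longrightarrow> sum g S \<le> sum g J"
  proof (intro allI impI)
    fix S :: "'a set" assume S: "card S = card J"
    show "sum g S \<le> sum g J"
    proof (cases "J = {}")
      case False
      define t where "t = Min (g ` J)"
      have "t \<in> g ` J" using False by (simp add: t_def)
      then have above: "g \<eta> \<le> t" if "\<eta> \<notin> J" for \<eta> using top that by auto
      have below: "t \<le> g \<xi>" if "\<xi> \<in> J" for \<xi> using that by (simp add: t_def)
      have "(\<Sum>\<xi>\<in>S. g \<xi> - t) \<le> (\<Sum>\<xi>\<in>S \<inter> J. g \<xi> - t)"
        using above by (subst sum.Int_Diff[of S _ J]) (auto intro!: sum_nonpos)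
      also have "\<dots> \<le> (\<Sum>\<xi>\<in>J. g \<xi> - t)"
        using below by (intro sum_mono2) auto
      finally show ?thesis
        using S by (simp add: sum_subtractf)
    qed (use S in simp)
  qed
next
  assume max: "\<forall>S::'a set. card S = card J \<longrightarrow> sum g S \<le> sum g J"
  show "\<forall>\<xi>\<in>J. \<forall>\<eta>\<in>- J. g \<eta> \<le> g \<xi>"
  proof (intro ballI)
    fix \<xi> \<eta> assume \<xi>: "\<xi> \<in> J" and \<eta>: "\<eta> \<in> - J"
    let ?S = "insert \<eta> (J - {\<xi>})"
    have "card J = Suc (card (J - {\<xi>}))"
      using \<xi> by (intro card.remove) simp_all
    then have "card ?S = card J"
      using \<eta> by simp
    then have "sum g ?S \<le> sum g J" using max by blast
    moreover have "sum g ?S = g \<eta> + (sum g J - g \<xi>)"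
      using \<xi> \<eta> by (simp add: sum_diff1)
    ultimately show "g \<eta> \<le> g \<xi>" by simp
  qed
qed

text \<open>
  By the law of cosines the squared chord from \<open>r\<close> to a point of the circle of radius \<open>r\<close> is
  \<open>2 r\<^sup>2 (1 - cos \<bar>Arg z\<bar>)\<close>, and the cosine is strictly decreasing on \<open>[0, \<pi>]\<close>.
\<close>

lemma abs_Arg_le_iff:
  assumes "cmod z = r" "cmod w = r" "r > 0"
  shows "\<bar>Arg z\<bar> \<le> \<bar>Arg w\<bar> \<longleftrightarrow> (cmod (z - of_real r))\<^sup>2 \<le> (cmod (w - of_real r))\<^sup>2"
proof -
  have chord: "(cmod (a - of_real r))\<^sup>2 = 2 * r\<^sup>2 * (1 - cos \<bar>Arg a\<bar>)" if "cmod a = r" for a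
  proof -
    have "Re a = r * cos (Arg a)"
      using that assms(3) cos_Arg[of a] by force
    moreover have "(Re a)\<^sup>2 + (Im a)\<^sup>2 = r\<^sup>2"
      using that cmod_power2[of a] by simp
    ultimately show ?thesis
      by (simp add: cmod_power2 power2_diff) (simp add: power2_eq_square algebra_simps)
  qed
  have "\<bar>Arg a\<bar> \<le> pi" for a
    using mpi_less_Arg[of a] Arg_le_pi[of a] by linarith
  then have "\<bar>Arg z\<bar> \<le> \<bar>Arg w\<bar> \<longleftrightarrow> cos \<bar>Arg w\<bar> \<le> cos \<bar>Arg z\<bar>"
    by (intro cos_mono_le_eq[symmetric]) auto
  then show ?thesis
    using assms by (simp add: chord)
qed

definition keep_on :: "real \<Rightarrow> ('n \<times> 'n) set \<Rightarrow> (complex, 'n::finite) array \<Rightarrow> (complex, 'n) array" where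
  "keep_on r J z = (\<chi> p q. if (p, q) \<in> J then z $ p $ q else of_real r)"

text \<open>
  Resetting a phase to \<open>0\<close> replaces the entry by the amplitude \<open>r\<close>, and keeping a phase keeps the
  entry, since \<open>z\<close> already has modulus \<open>r\<close>.
\<close>

lemma step1_step6_keep_on:
  fixes amp :: "(real, 'n::finite) array"
  assumes "\<And>p q. amp $ p $ q = r" "r > 0" "z \<in> Omega2 amp"
  shows "(\<exists>\<Phi>'. step6 s z \<Phi>' \<and> x' = step1 amp \<Phi>') \<longleftrightarrow> (\<exists>J\<in>C_set s (arg z). x' = keep_on r J z)"
proof -
  have "of_real r * exp (\<i> * of_real (Arg (z $ p $ q))) = z $ p $ q" for p q
    using assms Arg_eq[of "z $ p $ q"] by (force simp: Omega2_def)
  then have "step1 amp (\<chi> p q. if (p, q) \<in> J then arg z $ p $ q else 0) = keep_on r J z" for J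
    using assms(1) by (simp add: vec_eq_iff step1_def keep_on_def arg_def)
  then show ?thesis
    by (auto simp: step6_def)
qed

lemma keep_on_in_Omega3:
  assumes "\<And>p q. amp $ p $ q = r" "r > 0" "z \<in> Omega2 amp" "card J \<le> s"
  shows "keep_on r J z \<in> Omega3 amp s"
proof -
  have "{(p, q). arg (keep_on r J z) $ p $ q \<noteq> 0} \<subseteq> J"
    using assms(2) by (auto simp: arg_def keep_on_def)
  then have "norm0 (arg (keep_on r J z)) \<le> s"
    unfolding norm0_def using assms(4) by (meson card_mono finite le_trans)
  then show ?thesis
    using assms(1-3) by (simp add: Omega3_def Omega2_def keep_on_def)
qed

lemma norm_diff_keep_on:
  "(norm (z - keep_on r J z))\<^sup>2 = (\<Sum>\<xi>\<in>- J. (cmod (z $ fst \<xi> $ snd \<xi> - of_real r))\<^sup>2)"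
  unfolding norm_array_squared by (rule sum.mono_neutral_cong_right) (auto simp: keep_on_def)

text \<open>
  Among the arrays that equal \<open>r\<close> outside \<open>J\<close>, the array \<open>keep_on r J z\<close> is the orthogonal
  projection of \<open>z\<close>: the claim is Pythagoras.
\<close>

lemma keep_on_support_nearer:
  assumes "\<And>\<xi>. \<xi> \<notin> J \<Longrightarrow> w $ fst \<xi> $ snd \<xi> = of_real r"
  shows "norm (z - keep_on r J z) \<le> norm (z - w)"
    and "norm (z - w) \<le> norm (z - keep_on r J z) \<Longrightarrow> w = keep_on r J z"
proof -
  have split: "(norm (z - w))\<^sup>2 = (norm (z - keep_on r J z))\<^sup>2 + (norm (keep_on r J z - w))\<^sup>2"
    unfolding norm_array_squared sum.distrib[symmetric]
  proof (intro sum.cong refl)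
    fix \<xi> :: "'a \<times> 'a"
    show "(norm ((z - w) $ fst \<xi> $ snd \<xi>))\<^sup>2 = (norm ((z - keep_on r J z) $ fst \<xi> $ snd \<xi>))\<^sup>2 +
        (norm ((keep_on r J z - w) $ fst \<xi> $ snd \<xi>))\<^sup>2"
      using assms[of \<xi>] by (cases "\<xi> \<in> J") (simp_all add: keep_on_def)
  qed
  show "norm (z - keep_on r J z) \<le> norm (z - w)"
    by (rule power2_le_imp_le) (simp_all add: split)
  show "w = keep_on r J z" if "norm (z - w) \<le> norm (z - keep_on r J z)"
  proof -
    have "(norm (z - w))\<^sup>2 \<le> (norm (z - keep_on r J z))\<^sup>2"
      using that by (simp add: power_mono)
    then have "norm (keep_on r J z - w) = 0"
      by (simp add: split)
    then show ?thesis by simp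
  qed
qed

text \<open>
  The nonzero phases of \<open>w\<close> may be fewer than \<open>s\<close>. Enlarging their index set to exactly \<open>s\<close>
  elements, which is possible for \<open>s \<le> n\<^sup>2\<close>, makes it comparable with the members of \<open>C_set s\<close>.
\<close>

lemma Omega3_support:
  fixes w :: "(complex, 'n::finite) array"
  assumes "\<And>p q. amp $ p $ q = r" "r > 0" "w \<in> Omega3 amp s" "s \<le> CARD('n)\<^sup>2"
  obtains J where "card J = s" "\<And>\<xi>. \<xi> \<notin> J \<Longrightarrow> w $ fst \<xi> $ snd \<xi> = of_real r"
proof -
  let ?S = "{(p, q). arg w $ p $ q \<noteq> 0}"
  have "card ?S \<le> s"
    using assms(3) by (simp add: Omega3_def norm0_def)
  moreover have "s \<le> card (UNIV :: ('n \<times> 'n) set)"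
    using assms(4) by (simp add: power2_eq_square)
  ultimately obtain J where J: "?S \<subseteq> J" "card J = s"
    using exists_subset_between[of ?S s UNIV] by auto
  have "w $ fst \<xi> $ snd \<xi> = of_real r" if "\<xi> \<notin> J" for \<xi>
  proof -
    have "\<xi> \<notin> ?S" using J that by blast
    then have "Arg (w $ fst \<xi> $ snd \<xi>) = 0"
      by (auto simp: arg_def case_prod_beta)
    moreover have "cmod (w $ fst \<xi> $ snd \<xi>) = r"
      using assms(1,3) by (simp add: Omega3_def Omega2_def)
    ultimately show ?thesis
      using assms(2) Arg_eq[of "w $ fst \<xi> $ snd \<xi>"] by force
  qed
  then show ?thesis using J that by blast
qed

text \<open>
  Making the discarded values \<open>\<bar>z - r\<bar>\<^sup>2\<close> small in total is the same as making the kept ones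
  large in total, and the ordering by \<open>\<bar>z - r\<bar>\<close> is the ordering by \<open>\<bar>Arg z\<bar>\<close>.
\<close>

lemma C_set_arg_iff_nearest:
  fixes amp :: "(real, 'n::finite) array"
  assumes "\<And>p q. amp $ p $ q = r" "r > 0" "z \<in> Omega2 amp"
  shows "J \<in> C_set s (arg z) \<longleftrightarrow>
    card J = s \<and> (\<forall>S. card S = s \<longrightarrow> norm (z - keep_on r J z) \<le> norm (z - keep_on r S z))"
proof -
  define g where "g \<xi> = (cmod (z $ fst \<xi> $ snd \<xi> - of_real r))\<^sup>2" for \<xi>
  have mod: "cmod (z $ p $ q) = r" for p q
    using assms(1,3) by (simp add: Omega2_def)
  have compl: "sum g (- S) = sum g UNIV - sum g S" for S
    by (simp add: Compl_eq_Diff_UNIV sum_diff)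
  have "norm (z - keep_on r J z) \<le> norm (z - keep_on r S z) \<longleftrightarrow> sum g S \<le> sum g J" for S
  proof -
    have "norm (z - keep_on r J z) \<le> norm (z - keep_on r S z) \<longleftrightarrow> sum g (- J) \<le> sum g (- S)"
      unfolding g_def norm_diff_keep_on[symmetric] by (simp add: abs_le_square_iff[symmetric])
    then show ?thesis by (simp add: compl)
  qed
  moreover have "J \<in> C_set s (arg z) \<longleftrightarrow> card J = s \<and> (\<forall>\<xi>\<in>J. \<forall>\<eta>\<in>- J. g \<eta> \<le> g \<xi>)"
    by (auto simp: C_set_def arg_def g_def abs_Arg_le_iff[OF mod mod assms(2)] case_prod_beta)
  ultimately show ?thesis
    unfolding top_set_iff_max_sum by auto
qed

lemma keep_on_in_projection_Omega3:
  fixes amp :: "(real, 'n::finite) array"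
  assumes "\<And>p q. amp $ p $ q = r" "r > 0" "z \<in> Omega2 amp" "J \<in> C_set s (arg z)"
  shows "keep_on r J z \<in> projection (Omega3 amp s) z"
proof -
  have J: "card J = s" "\<And>S. card S = s \<Longrightarrow> norm (z - keep_on r J z) \<le> norm (z - keep_on r S z)"
    using assms(4)[unfolded C_set_arg_iff_nearest[OF assms(1-3)]] by simp_all
  have "norm (z - keep_on r J z) \<le> norm (z - w)" if w: "w \<in> Omega3 amp s" for w
  proof -
    have "s \<le> card (UNIV :: ('n \<times> 'n) set)"
      unfolding J(1)[symmetric] by (rule card_mono) auto
    then have "s \<le> CARD('n)\<^sup>2"
      by (simp add: power2_eq_square)
    then obtain S where S: "card S = s" "\<And>\<xi>. \<xi> \<notin> S \<Longrightarrow> w $ fst \<xi> $ snd \<xi> = of_real r"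
      using Omega3_support[OF assms(1,2) w] by blast
    have "norm (z - keep_on r J z) \<le> norm (z - keep_on r S z)"
      using S(1) by (rule J(2))
    also have "\<dots> \<le> norm (z - w)"
      using S(2) by (rule keep_on_support_nearer(1))
    finally show ?thesis .
  qed
  then show ?thesis
    unfolding projection_iff_nearest
    using keep_on_in_Omega3[OF assms(1-3)] J(1) by simp
qed

text \<open>
  Conversely, a nearest point \<open>w\<close> that equals \<open>r\<close> outside \<open>J\<close> cannot beat \<open>keep_on r J z\<close>, hence
  is equal to it; and then \<open>J\<close> is optimal because all \<open>keep_on r S z\<close> with \<open>card S = s\<close> compete.
\<close>

lemma projection_Omega3_is_keep_on:
  fixes amp :: "(real, 'n::finite) array"
  assumes "\<And>p q. amp $ p $ q = r" "r > 0" "z \<in> Omega2 amp"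
    and "s \<le> CARD('n)\<^sup>2" "w \<in> projection (Omega3 amp s) z"
  shows "\<exists>J\<in>C_set s (arg z). w = keep_on r J z"
proof -
  have w: "w \<in> Omega3 amp s" "\<And>v. v \<in> Omega3 amp s \<Longrightarrow> norm (z - w) \<le> norm (z - v)"
    using assms(5) by (auto simp: projection_iff_nearest)
  have admissible: "keep_on r S z \<in> Omega3 amp s" if "card S = s" for S
    using keep_on_in_Omega3[OF assms(1-3)] that by simp
  obtain J where J: "card J = s" "\<And>\<xi>. \<xi> \<notin> J \<Longrightarrow> w $ fst \<xi> $ snd \<xi> = of_real r"
    using Omega3_support[OF assms(1,2) w(1) assms(4)] by blast
  have "w = keep_on r J z"
    using J(2) w(2)[OF admissible[OF J(1)]] by (rule keep_on_support_nearer(2))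
  then show ?thesis
    using w(2) admissible J(1) C_set_arg_iff_nearest[OF assms(1-3)] by blast
qed

section \<open>The fixed point operator\<close>

theorem lemma2:
  fixes amp \<Phi>d b :: "(real, 'n::{finite,linorder}) array"
    and s :: nat and r c :: real
  assumes "r > 0" and "\<And>p q. amp $ p $ q = r"
    and "\<And>p q. b $ p $ q \<ge> 0"
    and "c > 0"
  shows "(\<forall>x y. steps234 c \<Phi>d b x y \<longleftrightarrow> y \<in> projection (Omega1 c \<Phi>d b) x)
    \<and> (\<forall>y z. step5 amp y z \<longleftrightarrow> z \<in> projection (Omega2 amp) y)
    \<and> (\<forall>z\<in>Omega2 amp. \<forall>x'.
         ((\<exists>\<Phi>'. step6 s z \<Phi>' \<and> x' = step1 amp \<Phi>') \<longrightarrow> x' \<in> projection (Omega3 amp s) z) \<and>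
         (s \<le> CARD('n)\<^sup>2 \<longrightarrow> x' \<in> projection (Omega3 amp s) z \<longrightarrow>
            (\<exists>\<Phi>'. step6 s z \<Phi>' \<and> x' = step1 amp \<Phi>')))
    \<and> (\<forall>\<Phi> x y z. srop_run c amp \<Phi>d b s \<Phi> x y z \<longrightarrow>
         (\<forall>k. y k \<in> projection (Omega1 c \<Phi>d b) (x k) \<and>
              z k \<in> projection (Omega2 amp) (y k) \<and>
              x (Suc k) \<in> projection (Omega3 amp s) (z k) \<and>
              x (Suc k) \<in> T_srop c amp \<Phi>d b s (x k)))
    \<and> (s \<le> CARD('n)\<^sup>2 \<longrightarrow> (\<forall>\<Phi>0 x.
         (\<exists>\<Phi> y z. \<Phi> 0 = \<Phi>0 \<and> srop_run c amp \<Phi>d b s \<Phi> x y z) \<longleftrightarrow>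
         x 0 = step1 amp \<Phi>0 \<and> (\<forall>k. x (Suc k) \<in> T_srop c amp \<Phi>d b s (x k))))"
proof -
  have nonneg: "\<And>p q. amp $ p $ q \<ge> 0"
    using assms(1,2) by simp
  have i: "steps234 c \<Phi>d b x y \<longleftrightarrow> y \<in> projection (Omega1 c \<Phi>d b) x" for x y
    using assms(3,4) by (rule steps234_iff_projection)
  have ii: "step5 amp y z \<longleftrightarrow> z \<in> projection (Omega2 amp) y" for y z
    using nonneg by (rule step5_iff_projection)
  have iii: "x' \<in> projection (Omega3 amp s) z"
    if "z \<in> Omega2 amp" "step6 s z \<Phi>'" "x' = step1 amp \<Phi>'" for z x' \<Phi>'
  proof -
    have "\<exists>J\<in>C_set s (arg z). x' = keep_on r J z"
      using that step1_step6_keep_on[OF assms(2,1) that(1), of s x'] by blast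
    then show ?thesis
      using keep_on_in_projection_Omega3[OF assms(2,1) that(1)] by blast
  qed
  have iii_conv: "\<exists>\<Phi>'. step6 s z \<Phi>' \<and> x' = step1 amp \<Phi>'"
    if "z \<in> Omega2 amp" "s \<le> CARD('n)\<^sup>2" "x' \<in> projection (Omega3 amp s) z" for z x'
    unfolding step1_step6_keep_on[OF assms(2,1) that(1)]
    using projection_Omega3_is_keep_on[OF assms(2,1) that] .
  have Omega2: "z \<in> Omega2 amp" if "z \<in> projection (Omega2 amp) y" for y z
    using that by (simp add: projection_def)
  have run: "y k \<in> projection (Omega1 c \<Phi>d b) (x k) \<and> z k \<in> projection (Omega2 amp) (y k) \<and>
      x (Suc k) \<in> projection (Omega3 amp s) (z k) \<and> x (Suc k) \<in> T_srop c amp \<Phi>d b s (x k)"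
    if "srop_run c amp \<Phi>d b s \<Phi> x y z" for \<Phi> x y z k
  proof -
    have y: "y k \<in> projection (Omega1 c \<Phi>d b) (x k)" and z: "z k \<in> projection (Omega2 amp) (y k)"
      using that unfolding srop_run_def i ii by blast+
    have "step6 s (z k) (\<Phi> (Suc k))" "x (Suc k) = step1 amp (\<Phi> (Suc k))"
      using that unfolding srop_run_def by blast+
    then have "x (Suc k) \<in> projection (Omega3 amp s) (z k)"
      using iii Omega2[OF z] by blast
    then show ?thesis
      using y z by (auto simp: T_srop_def)
  qed
  have realised: "\<exists>\<Phi> y z. \<Phi> 0 = \<Phi>0 \<and> srop_run c amp \<Phi>d b s \<Phi> x y z"
    if s: "s \<le> CARD('n)\<^sup>2" and x0: "x 0 = step1 amp \<Phi>0"
      and xT: "\<And>k. x (Suc k) \<in> T_srop c amp \<Phi>d b s (x k)" for \<Phi>0 x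
  proof -
    have "\<exists>y z \<Phi>'. steps234 c \<Phi>d b (x k) y \<and> step5 amp y z \<and> step6 s z \<Phi>' \<and>
        x (Suc k) = step1 amp \<Phi>'" for k
    proof -
      obtain y z where y: "y \<in> projection (Omega1 c \<Phi>d b) (x k)"
        and z: "z \<in> projection (Omega2 amp) y" and x: "x (Suc k) \<in> projection (Omega3 amp s) z"
        using xT[of k] by (auto simp: T_srop_def)
      then show ?thesis
        using i ii iii_conv[OF Omega2[OF z] s x] by blast
    qed
    then obtain y z \<Psi> where step: "\<And>k. steps234 c \<Phi>d b (x k) (y k) \<and> step5 amp (y k) (z k) \<and>
        step6 s (z k) (\<Psi> k) \<and> x (Suc k) = step1 amp (\<Psi> k)"
      by metis
    define \<Phi> where "\<Phi> = case_nat \<Phi>0 \<Psi>"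
    have "x k = step1 amp (\<Phi> k)" for k
      using x0 step by (cases k) (auto simp: \<Phi>_def)
    then have "srop_run c amp \<Phi>d b s \<Phi> x y z"
      using step by (auto simp: srop_run_def \<Phi>_def)
    moreover have "\<Phi> 0 = \<Phi>0" by (simp add: \<Phi>_def)
    ultimately show ?thesis by blast
  qed
  have start: "x 0 = step1 amp (\<Phi> 0)" if "srop_run c amp \<Phi>d b s \<Phi> x y z" for \<Phi> x y z
    using that by (simp add: srop_run_def)
  show ?thesis
  proof (intro conjI)
    show "\<forall>x y. steps234 c \<Phi>d b x y \<longleftrightarrow> y \<in> projection (Omega1 c \<Phi>d b) x"
      using i by blast
    show "\<forall>y z. step5 amp y z \<longleftrightarrow> z \<in> projection (Omega2 amp) y"
      using ii by blast
  next
    show "\<forall>z\<in>Omega2 amp. \<forall>x'.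
         ((\<exists>\<Phi>'. step6 s z \<Phi>' \<and> x' = step1 amp \<Phi>') \<longrightarrow> x' \<in> projection (Omega3 amp s) z) \<and>
         (s \<le> CARD('n)\<^sup>2 \<longrightarrow> x' \<in> projection (Omega3 amp s) z \<longrightarrow>
            (\<exists>\<Phi>'. step6 s z \<Phi>' \<and> x' = step1 amp \<Phi>'))"
      using iii iii_conv by blast
  next
    show "\<forall>\<Phi> x y z. srop_run c amp \<Phi>d b s \<Phi> x y z \<longrightarrow>
         (\<forall>k. y k \<in> projection (Omega1 c \<Phi>d b) (x k) \<and>
              z k \<in> projection (Omega2 amp) (y k) \<and>
              x (Suc k) \<in> projection (Omega3 amp s) (z k) \<and>
              x (Suc k) \<in> T_srop c amp \<Phi>d b s (x k))"
      using run by blast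
  next
    show "s \<le> CARD('n)\<^sup>2 \<longrightarrow> (\<forall>\<Phi>0 x.
         (\<exists>\<Phi> y z. \<Phi> 0 = \<Phi>0 \<and> srop_run c amp \<Phi>d b s \<Phi> x y z) \<longleftrightarrow>
         x 0 = step1 amp \<Phi>0 \<and> (\<forall>k. x (Suc k) \<in> T_srop c amp \<Phi>d b s (x k)))"
    proof (intro impI allI iffI)
      fix \<Phi>0 x
      assume "\<exists>\<Phi> y z. \<Phi> 0 = \<Phi>0 \<and> srop_run c amp \<Phi>d b s \<Phi> x y z"
      then show "x 0 = step1 amp \<Phi>0 \<and> (\<forall>k. x (Suc k) \<in> T_srop c amp \<Phi>d b s (x k))"
        using run start by blast
    next
      fix \<Phi>0 x
      assume "s \<le> CARD('n)\<^sup>2"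
        and "x 0 = step1 amp \<Phi>0 \<and> (\<forall>k. x (Suc k) \<in> T_srop c amp \<Phi>d b s (x k))"
      then show "\<exists>\<Phi> y z. \<Phi> 0 = \<Phi>0 \<and> srop_run c amp \<Phi>d b s \<Phi> x y z"
        using realised by blast
    qed
  qed
qed

end
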